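(* Let $H$ be a bipartite graph on at most $h$ vertices containing at least one cycle. Then for all sufficiently large $n$, $\mathrm{nim}_2(n;H)\le\mathrm{ex}(n,H)+h^2$.
   Context: For a 2-edge-colouring of $K_n$, an edge is a NIM-edge if it is not contained in any copy of $H$ all of whose edges have the same colour; $\mathrm{nim}_2(n;H)$ is the maximum number of NIM-edges over all 2-edge-colourings of $K_n$. $\mathrm{ex}(n,H)$ is the maximum number of edges of an $H$-free graph on $n$ vertices. *)

theory Defs
  imports Main "HOL-Library.FuncSet"
begin

text \<open>A graph is a pair of a vertex set and an edge set; edges are two-element sets of vertices.\<close>

type_synonym 'a ugraph = "'a set \<times> 'a set set"

abbreviation verts :: "'a ugraph \<Rightarrow> 'a set" where "verts G \<equiv> fst G"
abbreviation edges :: "'a ugraph \<Rightarrow> 'a set set" where "edges G \<equiv> snd G"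

definition all_edges :: "'a set \<Rightarrow> 'a set set" where
  "all_edges V = {e. e \<subseteq> V \<and> card e = 2}"

definition simple_graph :: "'a ugraph \<Rightarrow> bool" where
  "simple_graph G \<longleftrightarrow> finite (verts G) \<and> edges G \<subseteq> all_edges (verts G)"

definition complete_graph :: "nat \<Rightarrow> nat ugraph" where
  "complete_graph n = ({..<n}, all_edges {..<n})"

definition bipartite :: "'a ugraph \<Rightarrow> bool" where
  "bipartite G \<longleftrightarrow> (\<exists>A B. A \<union> B = verts G \<and> A \<inter> B = {} \<and>
     (\<forall>e\<in>edges G. \<exists>a\<in>A. \<exists>b\<in>B. e = {a, b}))"

definition is_cycle :: "'a ugraph \<Rightarrow> 'a list \<Rightarrow> bool" where
  "is_cycle G xs \<longleftrightarrow> 3 \<le> length xs \<and> distinct xs \<and> set xs \<subseteq> verts G \<and>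
     (\<forall>i<length xs. {xs ! i, xs ! (Suc i mod length xs)} \<in> edges G)"

definition contains_cycle :: "'a ugraph \<Rightarrow> bool" where
  "contains_cycle G \<longleftrightarrow> (\<exists>xs. is_cycle G xs)"

definition isomorphic :: "'a ugraph \<Rightarrow> 'b ugraph \<Rightarrow> bool" where
  "isomorphic G G' \<longleftrightarrow>
     (\<exists>f. bij_betw f (verts G) (verts G') \<and> (\<lambda>e. f ` e) ` edges G = edges G')"

definition subgraph :: "'a ugraph \<Rightarrow> 'a ugraph \<Rightarrow> bool" where
  "subgraph F G \<longleftrightarrow> simple_graph F \<and> verts F \<subseteq> verts G \<and> edges F \<subseteq> edges G"

text \<open>Copies are not required to be induced subgraphs.\<close>

definition copy_in :: "'b ugraph \<Rightarrow> 'a ugraph \<Rightarrow> 'a ugraph \<Rightarrow> bool" where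
  "copy_in H G F \<longleftrightarrow> subgraph F G \<and> isomorphic H F"

definition free_of :: "'b ugraph \<Rightarrow> 'a ugraph \<Rightarrow> bool" where
  "free_of H G \<longleftrightarrow> \<not> (\<exists>F. copy_in H G F)"

text \<open>If \<open>H\<close> has an edge, the set below is finite and nonempty (\<open>ex_set_finite\<close>, \<open>ex_set_nonempty\<close>),
  so that \<open>Max\<close> is meaningful.\<close>

definition ex :: "nat \<Rightarrow> 'b ugraph \<Rightarrow> nat" where
  "ex n H = Max {card (edges G) |G :: nat ugraph.
     simple_graph G \<and> verts G = {..<n} \<and> free_of H G}"

text \<open>Colourings need not be proper; their values outside the edge set are irrelevant.\<close>

definition edge_colouring :: "nat \<Rightarrow> 'a ugraph \<Rightarrow> ('a set \<Rightarrow> nat) \<Rightarrow> bool" where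
  "edge_colouring k G c \<longleftrightarrow> c \<in> edges G \<rightarrow> {..<k}"

definition monochromatic :: "('a set \<Rightarrow> nat) \<Rightarrow> 'a ugraph \<Rightarrow> bool" where
  "monochromatic c F \<longleftrightarrow> (\<exists>i. \<forall>e\<in>edges F. c e = i)"

definition nim_edges :: "nat \<Rightarrow> 'b ugraph \<Rightarrow> (nat set \<Rightarrow> nat) \<Rightarrow> nat set set" where
  "nim_edges n H c = {e \<in> edges (complete_graph n).
     \<not> (\<exists>F. copy_in H (complete_graph n) F \<and> monochromatic c F \<and> e \<in> edges F)}"

definition nim :: "nat \<Rightarrow> nat \<Rightarrow> 'b ugraph \<Rightarrow> nat" where
  "nim k n H = Max {card (nim_edges n H c) |c. edge_colouring k (complete_graph n) c}"

lemma finite_all_edges: "finite V \<Longrightarrow> finite (all_edges V)"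
  unfolding all_edges_def by simp

lemma ex_set_finite:
  "finite {card (edges G) |G :: nat ugraph. simple_graph G \<and> verts G = {..<n} \<and> free_of H G}"
proof (rule finite_subset)
  show "{card (edges G) |G :: nat ugraph. simple_graph G \<and> verts G = {..<n} \<and> free_of H G}
      \<subseteq> {..card (all_edges {..<n})}"
    by (auto simp: simple_graph_def intro!: card_mono finite_all_edges)
qed simp

lemma ex_set_nonempty:
  assumes "edges H \<noteq> {}"
  shows "{card (edges G) |G :: nat ugraph. simple_graph G \<and> verts G = {..<n} \<and> free_of H G} \<noteq> {}"
proof -
  have "simple_graph ({..<n}, {})" "free_of H ({..<n}, {})"
    using assms by (auto simp: simple_graph_def free_of_def copy_in_def subgraph_def isomorphic_def)
  then have "card (edges ({..<n}, {})) \<in> {card (edges G) |G :: nat ugraph. simple_graph G \<and> verts G = {..<n} \<and> free_of H G}"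
    by fastforce
  then show ?thesis by blast
qed

lemma nim_set_finite:
  "finite {card (nim_edges n H c) |c. edge_colouring k (complete_graph n) c}"
proof (rule finite_subset)
  show "{card (nim_edges n H c) |c. edge_colouring k (complete_graph n) c}
      \<subseteq> {..card (all_edges {..<n})}"
    by (auto simp: nim_edges_def complete_graph_def intro!: card_mono finite_all_edges)
qed simp

lemma nim_set_nonempty:
  assumes "k > 0"
  shows "{card (nim_edges n H c) |c. edge_colouring k (complete_graph n) c} \<noteq> {}"
proof -
  have "edge_colouring k (complete_graph n) (\<lambda>_. 0)"
    using assms by (simp add: edge_colouring_def)
  then show ?thesis by blast
qed

end

theory Submission
  imports "HOL-Library.Ramsey" Defs
begin

text \<open>The NIM-edges of either colour form an \<open>H\<close>-free graph. If all monochromatic NIM-degrees are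
  bounded, there are only linearly many NIM-edges, whereas \<open>ex n H\<close> is superlinear because \<open>H\<close>
  contains a cycle. So let \<open>x\<close> have many red NIM-neighbours. A red clique on them would put a
  NIM-edge at \<open>x\<close> into a red copy of \<open>H\<close>, so by Ramsey they contain a large blue clique \<open>A\<close>.
  Starting from \<open>{x}\<close>, greedily add vertices to a set \<open>U\<close> completely red to \<open>A\<close>, shrinking \<open>A\<close>,
  until every vertex outside \<open>U\<close> is blue to almost all of \<open>A\<close>. Since the edges at \<open>x\<close> are NIM,
  \<open>U\<close> stays smaller than the smaller part of \<open>H\<close>. Outside \<open>U\<close> any few vertices have many common blue
  neighbours in \<open>A\<close>, hence every blue NIM-edge meets \<open>U\<close> and each vertex of \<open>U\<close> lies on few blue
  NIM-edges: there are at most \<open>h\<^sup>2\<close> of them.\<close>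

section \<open>Degree counting and injections\<close>

lemma in_all_edges_iff: "e \<in> all_edges V \<longleftrightarrow> (\<exists>u v. e = {u, v} \<and> u \<in> V \<and> v \<in> V \<and> u \<noteq> v)"
  unfolding all_edges_def by (auto simp: card_2_iff)

lemma doubleton_in_all_edges_iff [simp]: "{u, v} \<in> all_edges V \<longleftrightarrow> u \<in> V \<and> v \<in> V \<and> u \<noteq> v"
  unfolding all_edges_def by (cases "u = v") auto

lemma singleton_notin_all_edges [simp]: "{x} \<notin> all_edges V"
  unfolding all_edges_def by simp

lemma card_incident_edges:
  assumes "E \<subseteq> all_edges V"
  shows "card {e \<in> E. x \<in> e} = card {y. {x, y} \<in> E}"
proof -
  have "bij_betw (\<lambda>y. {x, y}) {y. {x, y} \<in> E} {e \<in> E. x \<in> e}"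
  proof (rule bij_betwI')
    fix e assume e: "e \<in> {e \<in> E. x \<in> e}"
    then obtain u v where "e = {u, v}" using assms by (auto simp: in_all_edges_iff dest!: subsetD)
    then show "\<exists>y\<in>{y. {x, y} \<in> E}. e = {x, y}" using e by (auto simp: insert_commute)
  qed (auto simp: doubleton_eq_iff)
  then show ?thesis by (simp add: bij_betw_same_card)
qed

text \<open>The handshake lemma, as a double count of incidences.\<close>

lemma sum_degrees:
  assumes "finite V" "E \<subseteq> all_edges V"
  shows "(\<Sum>v\<in>V. card {e \<in> E. v \<in> e}) = 2 * card E"
proof (rule sum_multicount)
  show "finite E" using assms finite_all_edges finite_subset by blast
  show "\<forall>e\<in>E. card {v \<in> V. v \<in> e} = 2"
  proof
    fix e assume "e \<in> E"
    then have "e \<subseteq> V" "card e = 2" using assms by (auto simp: all_edges_def)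
    then show "card {v \<in> V. v \<in> e} = 2" by (metis Collect_mem_eq Int_def inf.absorb_iff2)
  qed
qed fact

text \<open>Needed to embed \<open>H\<close> so that a chosen edge of \<open>H\<close> lands on a
  prescribed edge.\<close>

lemma inj_into_with_value:
  assumes "finite P" "finite X" "card P \<le> card X" "p \<in> P" "x \<in> X"
  obtains f where "inj_on f P" "f ` P \<subseteq> X" "f p = x"
proof -
  have "card (P - {p}) \<le> card (X - {x})" using assms by simp
  then obtain g where g: "g ` (P - {p}) \<subseteq> X - {x}" "inj_on g (P - {p})"
    using card_le_inj[of "P - {p}" "X - {x}"] assms by auto
  have "inj_on (g(p := x)) P" using g by (auto simp: inj_on_def)
  moreover have "(g(p := x)) ` P \<subseteq> X" using g assms by auto
  ultimately show ?thesis using that by simp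
qed

lemma complete_graph_simps [simp]:
  "verts (complete_graph n) = {..<n}" "edges (complete_graph n) = all_edges {..<n}"
  by (simp_all add: complete_graph_def)

subsection \<open>Dense graphs without short cycles\<close>

definition no_short_cycle :: "nat \<Rightarrow> 'a ugraph \<Rightarrow> bool" where
  "no_short_cycle g G \<longleftrightarrow> (\<forall>xs. is_cycle G xs \<longrightarrow> g < length xs)"

text \<open>As a relation, so that \<open>adj E ^^ k\<close> describes walks of length
  \<open>k\<close>.\<close>

definition adj :: "'a set set \<Rightarrow> ('a \<times> 'a) set" where
  "adj E = {(a, b). {a, b} \<in> E}"

lemma relpow_adj_sym: "(a, b) \<in> adj E ^^ k \<Longrightarrow> (b, a) \<in> adj E ^^ k"
proof (induction k arbitrary: b)
  case (Suc k)
  then obtain c where "(a, c) \<in> adj E ^^ k" "(c, b) \<in> adj E" by auto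
  then show ?case
    using Suc.IH by (intro relpow_Suc_I2[of b c]) (auto simp: adj_def insert_commute)
qed simp

lemma relpow_image_bound:
  fixes R :: "('a \<times> 'a) set"
  assumes "\<And>a. finite (R `` {a})" "\<And>a. card (R `` {a}) \<le> d"
  shows "finite ((R ^^ k) `` {u}) \<and> card ((R ^^ k) `` {u}) \<le> d ^ k"
proof (induction k)
  case (Suc k)
  have eq: "(R ^^ Suc k) `` {u} = (\<Union>a\<in>(R ^^ k) `` {u}. R `` {a})"
    by auto
  have "card (\<Union>a\<in>(R ^^ k) `` {u}. R `` {a}) \<le> (\<Sum>a\<in>(R ^^ k) `` {u}. card (R `` {a}))"
    using Suc card_UN_le by blast
  also have "\<dots> \<le> card ((R ^^ k) `` {u}) * d"
    using sum_bounded_above[of "(R ^^ k) `` {u}" "\<lambda>a. card (R `` {a})" d] assms by simp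
  also have "\<dots> \<le> d ^ k * d" using Suc by (intro mult_right_mono) auto
  finally show ?case using Suc assms eq by (auto simp: mult.commute)
qed simp

text \<open>A short cycle must use the new edge, as \<open>E\<close> alone has none; the rest of the
  cycle is a walk in \<open>E\<close> between the ends of that edge.\<close>

lemma short_cycle_through_new_edge:
  assumes cyc: "is_cycle (V, insert {u, v} E) xs" "length xs \<le> g" and no: "no_short_cycle g (V, E)"
  shows "\<exists>k\<le>g. (u, v) \<in> adj E ^^ k"
proof -
  define L where "L = length xs"
  \<comment> \<open>\<open>p\<close> runs round the cycle periodically, so the walk can start just
    after the new edge, wherever that is.\<close>
  define p where "p j = xs ! (j mod L)" for j
  have L: "3 \<le> L" "L \<le> g" and dist: "distinct xs"
    using cyc by (auto simp: L_def is_cycle_def)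
  have e: "{p j, p (Suc j)} \<in> insert {u, v} E" for j
  proof -
    have "0 < L" using L by linarith
    then have "j mod L < length xs" unfolding L_def by (rule mod_less_divisor)
    then have "{xs ! (j mod L), xs ! (Suc (j mod L) mod length xs)} \<in> insert {u, v} E"
      using cyc by (simp add: is_cycle_def)
    then show ?thesis by (simp add: p_def L_def mod_Suc_eq)
  qed
  have "\<not> is_cycle (V, E) xs"
    using no cyc(2) by (auto simp: no_short_cycle_def)
  then obtain i where "i < L" "{xs ! i, xs ! (Suc i mod L)} \<notin> E"
    using cyc(1) unfolding is_cycle_def L_def by auto
  then have i: "{p i, p (Suc i)} \<notin> E" by (simp add: p_def)
  then have uv: "{p i, p (Suc i)} = {u, v}" using e by blast
  have pe: "p a = p b \<longleftrightarrow> a mod L = b mod L" for a b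
  proof -
    have "a mod L < length xs" "b mod L < length xs"
      using L mod_less_divisor[of L] unfolding L_def by (meson less_le_trans zero_less_numeral)+
    then show ?thesis using dist by (simp add: p_def nth_eq_iff_index_eq)
  qed
  \<comment> \<open>The new edge occurs only once on the cycle: a second traversal would have to be
    in the reverse direction, forcing \<open>L\<close> to divide both \<open>j\<close> and
    \<open>j + 2\<close>, hence \<open>2\<close>.\<close>
  have step: "(p (Suc i + j), p (Suc (Suc i + j))) \<in> adj E" if "j < L - 1" for j
  proof -
    have "{p (Suc i + j), p (Suc (Suc i + j))} \<noteq> {p i, p (Suc i)}"
    proof
      assume *: "{p (Suc i + j), p (Suc (Suc i + j))} = {p i, p (Suc i)}"
      have "(Suc i + j) mod L \<noteq> i mod L"
        using that L mod_eq_dvd_iff_nat[of i "Suc i + j" L] by (auto dest: dvd_imp_le)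
      then have "p (Suc i + j) = p (Suc i)" "p (Suc (Suc i + j)) = p i"
        using * pe by (auto simp: doubleton_eq_iff)
      then have "(Suc i + j) mod L = Suc i mod L" "Suc (Suc i + j) mod L = i mod L"
        using pe by auto
      then have "L dvd j" "L dvd j + 2"
        using mod_eq_dvd_iff_nat[of "Suc i" "Suc i + j" L] mod_eq_dvd_iff_nat[of i "Suc (Suc i + j)" L]
        by auto
      then have "L dvd 2" using dvd_add_right_iff by blast
      then show False using L by (auto dest: dvd_imp_le)
    qed
    then show ?thesis using e[of "Suc i + j"] uv by (auto simp: adj_def)
  qed
  have "(p (Suc i), p (Suc i + k)) \<in> adj E ^^ k" if "k \<le> L - 1" for k
    using that
  proof (induction k)
    case (Suc k)
    then show ?case using step[of k] by (auto intro: relcompI)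
  qed simp
  from this[of "L - 1"] have "(p (Suc i), p i) \<in> adj E ^^ (L - 1)"
    using L by (simp add: p_def)
  then have "(u, v) \<in> adj E ^^ (L - 1)"
    using uv relpow_adj_sym by (fastforce simp: doubleton_eq_iff)
  then show ?thesis using L by (intro exI[of _ "L - 1"]) auto
qed

text \<open>In an edge-maximal graph with maximum degree at most \<open>d\<close> and no short cycle, the vertices of
  degree less than \<open>d\<close> are pairwise at bounded distance, so there are boundedly many of them.\<close>

lemma dense_graph_no_short_cycle:
  fixes V :: "'a set"
  assumes "finite V"
  obtains E where "E \<subseteq> all_edges V" "no_short_cycle g (V, E)"
    "d * card V \<le> 2 * card E + d * (\<Sum>k\<le>Suc g. d ^ k)"
proof -
  define good where "good E \<longleftrightarrow> E \<subseteq> all_edges V \<and> no_short_cycle g (V, E) \<and>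
    (\<forall>v. card {e \<in> E. v \<in> e} \<le> d)" for E
  have "\<not> is_cycle (V, {}) xs" for xs by (cases xs) (auto simp: is_cycle_def)
  then have "good {}" by (simp add: good_def no_short_cycle_def)
  moreover have "\<forall>E. good E \<longrightarrow> card E < Suc (card (all_edges V))"
    using assms by (auto simp: good_def less_Suc_eq_le intro!: card_mono finite_all_edges)
  ultimately obtain E where E: "good E" and mx: "\<And>E'. good E' \<Longrightarrow> card E' \<le> card E"
    using ex_has_greatest_nat[of good "{}" card "Suc (card (all_edges V))"] by (metis less_imp_le)
  \<comment> \<open>Bounds the size of a ball of radius \<open>Suc g\<close>. The radius is
    \<open>Suc g\<close> rather than \<open>g\<close> so that neighbours are covered even if
    \<open>g = 0\<close>.\<close>
  define C where "C = (\<Sum>k\<le>Suc g. d ^ k)"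
  have sub: "E \<subseteq> all_edges V" and no: "no_short_cycle g (V, E)"
    and deg: "\<And>v. card {e \<in> E. v \<in> e} \<le> d"
    using E by (auto simp: good_def)
  have finE: "finite E" using sub assms finite_all_edges finite_subset by blast
  define L where "L = {v \<in> V. card {e \<in> E. v \<in> e} < d}"
  have finL: "finite L" using assms by (simp add: L_def)
  have "card L \<le> C"
  proof (cases "L = {}")
    case False
    then obtain u where u: "u \<in> L" by blast
    have reach: "v \<in> (\<Union>k\<le>Suc g. (adj E ^^ k) `` {u})" if v: "v \<in> L" for v
    proof -
      consider "v = u" | "{u, v} \<in> E" | "v \<noteq> u" "{u, v} \<notin> E" by blast
      then show ?thesis
      proof cases
        case 1
        then have "v \<in> (adj E ^^ 0) `` {u}" by simp
        then show ?thesis by blast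
      next
        case 2
        then have "v \<in> (adj E ^^ 1) `` {u}" by (simp add: adj_def)
        then show ?thesis by (intro UN_I[of 1]) auto
      next
        case 3
        let ?E = "insert {u, v} E"
        have uv: "u \<in> V" "v \<in> V" "u \<noteq> v" using u v 3 by (auto simp: L_def)
        have "card ?E > card E" using 3 finE by simp
        then have "\<not> good ?E" using mx not_less by blast
        moreover have "card {e \<in> ?E. w \<in> e} \<le> d" for w
        proof (cases "w \<in> {u, v}")
          case True
          then have "card {e \<in> E. w \<in> e} < d" using u v by (auto simp: L_def)
          moreover have "{e \<in> ?E. w \<in> e} = insert {u, v} {e \<in> E. w \<in> e}" using True by auto
          ultimately show ?thesis using finE by (simp add: card_insert_if)
        next
          case False
          then have "{e \<in> ?E. w \<in> e} = {e \<in> E. w \<in> e}" by auto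
          then show ?thesis using deg by simp
        qed
        ultimately have "\<not> no_short_cycle g (V, ?E)"
          using sub uv by (auto simp: good_def)
        then show ?thesis
          using short_cycle_through_new_edge[OF _ _ no] by (fastforce simp: no_short_cycle_def not_less intro: le_SucI)
      qed
    qed
    have nb: "adj E `` {a} = {b. {a, b} \<in> E}" for a by (auto simp: adj_def)
    have fin: "finite (adj E `` {a})" for a
    proof (rule finite_subset[of _ V])
      show "adj E `` {a} \<subseteq> V" using sub by (auto simp: adj_def)
    qed fact
    have "card (adj E `` {a}) \<le> d" for a
      using deg[of a] card_incident_edges[OF sub, of a] nb[of a] by simp
    note B = relpow_image_bound[of "adj E", OF fin this]
    have "card L \<le> card (\<Union>k\<le>Suc g. (adj E ^^ k) `` {u})"
      using reach B by (intro card_mono) auto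
    also have "\<dots> \<le> (\<Sum>k\<le>Suc g. card ((adj E ^^ k) `` {u}))" by (intro card_UN_le) simp
    also have "\<dots> \<le> C" unfolding C_def using B by (intro sum_mono) blast
    finally show ?thesis .
  qed simp
  \<comment> \<open>Vertices outside \<open>L\<close> already have degree at least \<open>d\<close>;
    each vertex of \<open>L\<close> is credited a further \<open>d\<close>.\<close>
  have "d * card V = (\<Sum>v\<in>V. d)" by simp
  also have "\<dots> \<le> (\<Sum>v\<in>V. card {e \<in> E. v \<in> e} + (if v \<in> L then d else 0))"
    by (intro sum_mono) (auto simp: L_def)
  also have "\<dots> = 2 * card E + d * card L"
    using sum_degrees[OF assms sub] assms
    by (simp add: sum.distrib sum.If_cases L_def Int_def conj_commute)
  also have "\<dots> \<le> 2 * card E + d * C" using \<open>card L \<le> C\<close> by simp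
  finally show ?thesis using that sub no C_def by blast
qed

text \<open>A copy of \<open>H\<close> carries the cycle of \<open>H\<close> to a cycle of the same
  length, which is at most \<open>card (verts H)\<close>.\<close>

lemma no_short_cycle_imp_free:
  assumes H: "simple_graph H" "card (verts H) \<le> g" "is_cycle H xs" and no: "no_short_cycle g G"
  shows "free_of H G"
  unfolding free_of_def
proof
  assume "\<exists>F. copy_in H G F"
  then obtain F f where F: "subgraph F G" and f: "bij_betw f (verts H) (verts F)"
    and fe: "(\<lambda>e. f ` e) ` edges H = edges F"
    by (auto simp: copy_in_def isomorphic_def)
  have xs: "3 \<le> length xs" "distinct xs" "set xs \<subseteq> verts H"
    "\<And>i. i < length xs \<Longrightarrow> {xs ! i, xs ! (Suc i mod length xs)} \<in> edges H"
    using H by (auto simp: is_cycle_def)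
  have "{map f xs ! i, map f xs ! (Suc i mod length xs)} \<in> edges G" if "i < length xs" for i
  proof -
    have "Suc i mod length xs < length xs" using xs(1) by (intro mod_less_divisor) auto
    then have "{map f xs ! i, map f xs ! (Suc i mod length xs)} =
      f ` {xs ! i, xs ! (Suc i mod length xs)}" using that by simp
    also have "\<dots> \<in> edges F" using fe xs(4)[OF that] by blast
    finally show ?thesis using F by (auto simp: subgraph_def)
  qed
  moreover have "distinct (map f xs)"
    using xs f by (auto simp: distinct_map bij_betw_def intro: inj_on_subset)
  moreover have "set (map f xs) \<subseteq> verts G"
    using xs(3) f F by (auto simp: bij_betw_def subgraph_def)
  ultimately have "is_cycle G (map f xs)" using xs(1) by (simp add: is_cycle_def)
  then have "g < length xs" using no by (auto simp: no_short_cycle_def)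
  moreover have "length xs \<le> card (verts H)"
    using xs H distinct_card[of xs] card_mono[of "verts H" "set xs"] by (simp add: simple_graph_def)
  ultimately show False using H by simp
qed

lemma card_edges_le_ex:
  assumes "E \<subseteq> all_edges {..<n}" "free_of H ({..<n}, E)"
  shows "card E \<le> ex n H"
  unfolding ex_def
proof (rule Max_ge[OF ex_set_finite])
  show "card E \<in> {card (edges G) |G :: nat ugraph.
      simple_graph G \<and> verts G = {..<n} \<and> free_of H G}"
    using assms by (intro CollectI exI[of _ "({..<n}, E)"]) (simp add: simple_graph_def)
qed

lemma ex_superlinear:
  assumes "simple_graph H" "contains_cycle H"
  shows "\<exists>n0. \<forall>n\<ge>n0. d * n \<le> ex n H"
proof -
  obtain xs where xs: "is_cycle H xs" using assms by (auto simp: contains_cycle_def)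
  define g where "g = card (verts H)"
  \<comment> \<open>The factor \<open>2\<close> compensates for the handshake count; the summand
    \<open>2\<close> absorbs the constant \<open>C\<close> once \<open>n\<close> is at least
    \<open>C\<close>.\<close>
  define d' where "d' = 2 * d + 2"
  define C where "C = d' * (\<Sum>k\<le>Suc g. d' ^ k)"
  have "d * n \<le> ex n H" if n: "C \<le> n" for n
  proof -
    obtain E where E: "E \<subseteq> all_edges {..<n}" "no_short_cycle g ({..<n}, E)"
      "d' * n \<le> 2 * card E + C"
      using dense_graph_no_short_cycle[of "{..<n}" g d'] by (auto simp: C_def)
    have "card E \<le> ex n H"
      using no_short_cycle_imp_free[OF assms(1) _ xs E(2)] E(1) by (intro card_edges_le_ex) (auto simp: g_def)
    moreover have "2 * (d * n) + C \<le> d' * n" using n by (simp add: d'_def algebra_simps)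
    ultimately show ?thesis using E(3) by linarith
  qed
  then show ?thesis by blast
qed

subsection \<open>Embedding into monochromatic bicliques and cliques\<close>

lemma nim_edges_subset: "nim_edges n H c \<subseteq> all_edges {..<n}"
  by (auto simp: nim_edges_def)

lemma nim_edge_cases:
  assumes "e \<in> nim_edges n H c"
  obtains v w where "e = {v, w}" "v < n" "w < n" "v \<noteq> w"
proof -
  have "e \<in> all_edges {..<n}" using assms nim_edges_subset[of n H c] by blast
  then show ?thesis using that by (auto simp: in_all_edges_iff)
qed

text \<open>The edge \<open>{p, q}\<close> is the one to be mapped onto a supposed NIM-edge.
  \<open>P\<close> is the smaller part, which limits the size of the greedily built set
  \<open>U\<close>.\<close>

locale bipartite_edge =
  fixes H :: "'a ugraph" and P Q :: "'a set" and p q :: 'a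
  assumes simple: "simple_graph H"
    and parts: "P \<union> Q = verts H" "P \<inter> Q = {}"
    and edges_between: "\<And>e. e \<in> edges H \<Longrightarrow> \<exists>a\<in>P. \<exists>b\<in>Q. e = {a, b}"
    and edge: "p \<in> P" "q \<in> Q" "{p, q} \<in> edges H"
    and card_parts: "card P \<le> card Q"
begin

lemma finite_parts: "finite P" "finite Q"
  using simple parts by (auto simp: simple_graph_def intro: finite_subset)

lemma card_verts: "card (verts H) = card P + card Q"
  using card_Un_disjoint[OF finite_parts parts(2)] parts(1) by simp

lemma card_parts_pos: "0 < card P" "0 < card Q"
  using finite_parts edge by (auto simp: card_gt_0_iff)

text \<open>Mapping \<open>P\<close> into \<open>X\<close> and \<open>Q\<close> into
  \<open>Y\<close> with \<open>p\<close> to \<open>x\<close> and \<open>q\<close> to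
  \<open>y\<close> gives a copy of \<open>H\<close> through \<open>{x, y}\<close> that uses only
  edges between \<open>X\<close> and \<open>Y\<close>.\<close>

lemma biclique_not_nim:
  assumes X: "X \<subseteq> {..<n}" and Y: "Y \<subseteq> {..<n}" and XY: "X \<inter> Y = {}"
    and card: "card P \<le> card X" "card Q \<le> card Y" and xy: "x \<in> X" "y \<in> Y"
    and col: "\<And>x y. x \<in> X \<Longrightarrow> y \<in> Y \<Longrightarrow> c {x, y} = i"
  shows "{x, y} \<notin> nim_edges n H c"
proof -
  have "finite X" "finite Y" using X Y finite_subset by blast+
  then obtain f g where f: "inj_on f P" "f ` P \<subseteq> X" "f p = x"
    and g: "inj_on g Q" "g ` Q \<subseteq> Y" "g q = y"
    using inj_into_with_value[OF finite_parts(1) _ card(1) edge(1) xy(1)]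
      inj_into_with_value[OF finite_parts(2) _ card(2) edge(2) xy(2)] by metis
  define m where "m v = (if v \<in> P then f v else g v)" for v
  have mP: "m v = f v" "f v \<in> X" if "v \<in> P" for v using that f by (auto simp: m_def)
  have mQ: "m v = g v" "g v \<in> Y" if "v \<in> Q" for v using that g parts by (auto simp: m_def)
  have inj: "inj_on m (verts H)"
  proof (rule inj_onI)
    fix v w assume vw: "v \<in> verts H" "w \<in> verts H" "m v = m w"
    then have "v \<in> P \<and> w \<in> P \<or> v \<in> Q \<and> w \<in> Q" using parts mP mQ XY by (metis UnE disjoint_iff)
    then show "v = w" using vw f(1) g(1) mP mQ by (auto dest: inj_onD)
  qed
  define F where "F = (m ` verts H, (\<lambda>e. m ` e) ` edges H)"
  have img: "\<exists>a\<in>X. \<exists>b\<in>Y. e = {a, b}" if e: "e \<in> edges F" for e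
  proof -
    obtain e' where e': "e' \<in> edges H" "e = m ` e'" using e by (auto simp: F_def)
    obtain a b where "a \<in> P" "b \<in> Q" "e' = {a, b}" using edges_between[OF e'(1)] by blast
    then show ?thesis using mP[of a] mQ[of b] e'(2) by auto
  qed
  have "e \<in> all_edges (verts F)" if e: "e \<in> edges F" for e
  proof -
    have "e \<subseteq> verts F" using e simple by (fastforce simp: F_def simple_graph_def all_edges_def)
    moreover obtain a b where "e = {a, b}" "a \<in> X" "b \<in> Y" using img[OF e] by blast
    moreover have "a \<noteq> b" using calculation XY by blast
    ultimately show ?thesis by simp
  qed
  then have "edges F \<subseteq> all_edges (verts F)" ..
  moreover have "finite (verts F)" using simple by (simp add: F_def simple_graph_def)
  moreover have "verts F \<subseteq> {..<n}" using mP mQ X Y parts(1) by (force simp: F_def)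
  moreover have "edges F \<subseteq> all_edges {..<n}" using img X Y XY by fastforce
  ultimately have "subgraph F (complete_graph n)"
    by (simp add: subgraph_def simple_graph_def)
  moreover have "isomorphic H F"
    using inj by (auto simp: isomorphic_def F_def intro!: exI[of _ m] inj_on_imp_bij_betw)
  moreover have "monochromatic c F" using img col by (fastforce simp: monochromatic_def)
  moreover have "{x, y} \<in> edges F"
  proof -
    have "m ` {p, q} = {x, y}" using mP(1) mQ(1) edge f g by simp
    then have "{x, y} \<in> (\<lambda>e. m ` e) ` edges H" using edge(3) by (metis imageI)
    then show ?thesis by (simp add: F_def)
  qed
  ultimately have "copy_in H (complete_graph n) F \<and> monochromatic c F \<and> {x, y} \<in> edges F"
    by (simp add: copy_in_def)
  then show ?thesis unfolding nim_edges_def by blast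
qed

text \<open>Splitting the clique into \<open>card P\<close> vertices including \<open>x\<close> and
  a remainder including \<open>y\<close> reduces this to the biclique case.\<close>

lemma clique_not_nim:
  assumes K: "K \<subseteq> {..<n}" "card (verts H) \<le> card K" and xy: "x \<in> K" "y \<in> K" "x \<noteq> y"
    and col: "\<And>v w. v \<in> K \<Longrightarrow> w \<in> K \<Longrightarrow> v \<noteq> w \<Longrightarrow> c {v, w} = i"
  shows "{x, y} \<notin> nim_edges n H c"
proof -
  have finK: "finite K" using K finite_subset by blast
  have cK: "card (K - {x, y}) = card K - 2" using xy finK by (simp add: card_Diff_subset)
  then have "card P - 1 \<le> card (K - {x, y})" using K(2) card_verts card_parts_pos by linarith
  then obtain A where A: "A \<subseteq> K - {x, y}" "card A = card P - 1" "finite A"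
    by (meson obtain_subset_with_card_n)
  let ?X = "insert x A"
  have X: "?X \<subseteq> K" "card ?X = card P"
    using A xy card_parts_pos by (auto simp: card_insert_if)
  then have "card (K - ?X) = card K - card P" using finK A by (simp add: card_Diff_subset)
  then have "card Q \<le> card (K - ?X)" using K(2) card_verts by linarith
  then show ?thesis
    using X A xy K(1) by (intro biclique_not_nim[of ?X n "K - ?X" x y c i] col) auto
qed

text \<open>A copy of \<open>H\<close> among these edges would be monochromatic and, since
  \<open>H\<close> has an edge, would contain a NIM-edge.\<close>

lemma nim_colour_class_le_ex:
  "card {e \<in> nim_edges n H c. c e = i} \<le> ex n H" (is "card ?N \<le> _")
proof (rule card_edges_le_ex)
  show N: "?N \<subseteq> all_edges {..<n}" using nim_edges_subset by blast
  show "free_of H ({..<n}, ?N)"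
    unfolding free_of_def
  proof
    assume "\<exists>F. copy_in H ({..<n}, ?N) F"
    then obtain F where F: "simple_graph F" "verts F \<subseteq> {..<n}" "edges F \<subseteq> ?N" "isomorphic H F"
      by (auto simp: copy_in_def subgraph_def)
    then have "copy_in H (complete_graph n) F"
      using N by (auto simp: copy_in_def subgraph_def)
    moreover have "monochromatic c F" using F(3) by (auto simp: monochromatic_def intro!: exI[of _ i])
    moreover have "edges F \<noteq> {}" using F(4) edge by (auto simp: isomorphic_def)
    ultimately obtain e where "e \<in> edges F" "e \<notin> nim_edges n H c"
      unfolding nim_edges_def by blast
    then show False using F(3) by blast
  qed
qed

end

subsection \<open>A vertex with many NIM-edges of one colour\<close>

text \<open>\<open>j\<close> counts the moves still available and \<open>g j\<close> is the size
  that \<open>A\<close> must then have. A move adds a vertex to \<open>U\<close> and shrinks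
  \<open>A\<close> to its \<open>R\<close>-neighbours; the process ends when the moves run out or no
  vertex has enough \<open>R\<close>-neighbours for another.\<close>

lemma greedy_extension:
  fixes g :: "nat \<Rightarrow> nat"
  assumes "finite V" "U \<subseteq> V" "U \<inter> A = {}" "\<forall>u\<in>U. \<forall>a\<in>A. R u a" "g j \<le> card A"
  shows "\<exists>U' A' j'. U \<subseteq> U' \<and> U' \<subseteq> V \<and> A' \<subseteq> A \<and> U' \<inter> A' = {} \<and> (\<forall>u\<in>U'. \<forall>a\<in>A'. R u a) \<and>
    card U' + j' = card U + j \<and> g j' \<le> card A' \<and>
    (j' = 0 \<or> (\<forall>v\<in>V - U'. card {a \<in> A'. a \<noteq> v \<and> R v a} < g (j' - 1)))"
  using assms
proof (induction j arbitrary: U A)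
  case 0
  then show ?case by (intro exI[of _ U] exI[of _ A] exI[of _ 0]) simp
next
  case (Suc j)
  show ?case
  proof (cases "\<forall>v\<in>V - U. card {a \<in> A. a \<noteq> v \<and> R v a} < g j")
    case True
    then show ?thesis using Suc.prems by (intro exI[of _ U] exI[of _ A] exI[of _ "Suc j"]) simp
  next
    case False
    then obtain v where v: "v \<in> V" "v \<notin> U" and large: "g j \<le> card {a \<in> A. a \<noteq> v \<and> R v a}"
      by (auto simp: not_less)
    \<comment> \<open>\<open>v\<close> may lie in \<open>A\<close> itself; dropping it keeps the
      enlarged \<open>U\<close> disjoint from the new \<open>A\<close>.\<close>
    let ?A = "{a \<in> A. a \<noteq> v \<and> R v a}"
    have "finite U" using Suc.prems finite_subset by blast
    then have card: "card (insert v U) + j = card U + Suc j" using v by simp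
    have "insert v U \<subseteq> V" "insert v U \<inter> ?A = {}" "\<forall>u\<in>insert v U. \<forall>a\<in>?A. R u a"
      using Suc.prems v by auto
    from Suc.IH[OF Suc.prems(1) this large, unfolded card] obtain U' A' j' where
      *: "insert v U \<subseteq> U'" "U' \<subseteq> V" "A' \<subseteq> ?A" "U' \<inter> A' = {}" "\<forall>u\<in>U'. \<forall>a\<in>A'. R u a"
      "card U' + j' = card U + Suc j" "g j' \<le> card A'"
      "j' = 0 \<or> (\<forall>v\<in>V - U'. card {a \<in> A'. a \<noteq> v \<and> R v a} < g (j' - 1))"
      by (elim exE conjE)
    show ?thesis
    proof (intro exI conjI)
      show "U \<subseteq> U'" using *(1) by blast
      show "A' \<subseteq> A" using *(3) by blast
    qed (fact *)+
  qed
qed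

text \<open>Chosen so that a set of size \<open>threshold h (Suc j)\<close> keeps at least
  \<open>h\<close> elements after losing \<open>h\<close> of them and then
  \<open>threshold h j\<close> for each of \<open>h\<close> vertices.\<close>

fun threshold :: "nat \<Rightarrow> nat \<Rightarrow> nat" where
  "threshold h 0 = h"
| "threshold h (Suc j) = h * threshold h j + 2 * h"

context bipartite_edge
begin

text \<open>Colour \<open>i\<close> is the red and \<open>j\<close> the blue of the overview. There
  are \<open>card P - 1\<close> greedy moves because \<open>U\<close> starts with the one vertex
  \<open>x\<close> and must not reach size \<open>card P\<close>.\<close>

lemma opposite_colour_class_bounded:
  assumes h: "card (verts H) \<le> h" and ij: "i \<noteq> j"
    and col: "\<And>e. e \<in> all_edges {..<n} \<Longrightarrow> c e = i \<or> c e = j"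
    and x: "x < n" and A: "A \<subseteq> {..<n}" "x \<notin> A" "threshold h (card P - 1) \<le> card A"
    and xA: "\<And>a. a \<in> A \<Longrightarrow> {x, a} \<in> nim_edges n H c \<and> c {x, a} = i"
    and clique: "\<And>v w. v \<in> A \<Longrightarrow> w \<in> A \<Longrightarrow> v \<noteq> w \<Longrightarrow> c {v, w} = j"
  shows "card {e \<in> nim_edges n H c. c e = j} \<le> h\<^sup>2"
proof -
  have h2: "card P + card Q \<le> h" using h card_verts by simp
  obtain U B k where U: "{x} \<subseteq> U" "U \<subseteq> {..<n}" and B: "B \<subseteq> A" "U \<inter> B = {}"
    and UB: "\<forall>u\<in>U. \<forall>b\<in>B. c {u, b} = i"
    and cU: "card U + k = card {x} + (card P - 1)" and cB: "threshold h k \<le> card B"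
    and stop: "k = 0 \<or> (\<forall>v\<in>{..<n} - U. card {a \<in> B. a \<noteq> v \<and> c {v, a} = i} < threshold h (k - 1))"
    using greedy_extension[of "{..<n}" "{x}" A "\<lambda>u v. c {u, v} = i" "threshold h" "card P - 1"]
      x A xA by auto
  have Bn: "B \<subseteq> {..<n}" using B A by blast
  have fin: "finite U" "finite B" using U Bn finite_subset by blast+
  \<comment> \<open>Otherwise \<open>U\<close> and \<open>B\<close> span a biclique of colour
    \<open>i\<close> large enough for \<open>H\<close>, contradicting that the edges from
    \<open>x\<close> to \<open>B\<close> are NIM.\<close>
  have "k \<noteq> 0"
  proof
    assume "k = 0"
    then have "card U = card P" "card Q \<le> card B"
      using cU cB card_parts_pos h2 by auto
    moreover obtain b where "b \<in> B" using \<open>card Q \<le> card B\<close> card_parts_pos by fastforce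
    ultimately have "{x, b} \<notin> nim_edges n H c"
      using U Bn B UB by (intro biclique_not_nim[of U n B x b c i]) auto
    then show False using xA B \<open>b \<in> B\<close> by blast
  qed
  then obtain l where l: "k = Suc l" by (cases k) auto
  then have few: "card {a \<in> B. a \<noteq> v \<and> c {v, a} = i} \<le> threshold h l" if "v < n" "v \<notin> U" for v
    using stop that by (auto intro: less_imp_le)
  \<comment> \<open>From \<open>B\<close>, at most \<open>h\<close> vertices are lost to
    \<open>W\<close> itself and at most \<open>threshold h l\<close> to each member of
    \<open>W\<close>.\<close>
  have common: "h \<le> card {b \<in> B - W. \<forall>w\<in>W. c {w, b} = j}" (is "h \<le> card ?C")
    if W: "W \<subseteq> {..<n} - U" "card W \<le> h" for W
  proof -
    have finW: "finite W" using W finite_subset by blast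
    have "B \<subseteq> ?C \<union> W \<union> (\<Union>w\<in>W. {a \<in> B. a \<noteq> w \<and> c {w, a} = i})"
    proof
      fix b assume b: "b \<in> B"
      have "c {w, b} = i \<or> c {w, b} = j" if "w \<in> W" "b \<noteq> w" for w
        using col[of "{w, b}"] that b W Bn by auto
      then show "b \<in> ?C \<union> W \<union> (\<Union>w\<in>W. {a \<in> B. a \<noteq> w \<and> c {w, a} = i})" using b by blast
    qed
    then have "card B \<le> card (?C \<union> W \<union> (\<Union>w\<in>W. {a \<in> B. a \<noteq> w \<and> c {w, a} = i}))"
      using fin finW by (intro card_mono) auto
    also have "\<dots> \<le> card ?C + card W + card (\<Union>w\<in>W. {a \<in> B. a \<noteq> w \<and> c {w, a} = i})"
      by (meson card_Un_le add_le_mono1 le_trans)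
    also have "card (\<Union>w\<in>W. {a \<in> B. a \<noteq> w \<and> c {w, a} = i}) \<le>
        (\<Sum>w\<in>W. card {a \<in> B. a \<noteq> w \<and> c {w, a} = i})"
      using finW card_UN_le by blast
    also have "\<dots> \<le> card W * threshold h l"
      using few W(1) sum_bounded_above[of W "\<lambda>w. card {a \<in> B. a \<noteq> w \<and> c {w, a} = i}" "threshold h l"]
      by (auto simp: subset_iff)
    also have "\<dots> \<le> h * threshold h l" using W by simp
    finally show ?thesis using cB l W(2) by simp
  qed
  let ?N = "{e \<in> nim_edges n H c. c e = j}"
  define T where "T u = {v \<in> {..<n} - U. {u, v} \<in> ?N}" for u
  \<comment> \<open>If both ends avoid \<open>U\<close>, then together with their common
    \<open>j\<close>-neighbours in the \<open>j\<close>-clique \<open>B\<close> they form a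
    \<open>j\<close>-clique with at least \<open>h\<close> vertices.\<close>
  have touch: "e \<inter> U \<noteq> {}" if e: "e \<in> ?N" for e
  proof
    assume disj: "e \<inter> U = {}"
    obtain v w where vw: "e = {v, w}" "v < n" "w < n" "v \<noteq> w"
      using e by (auto elim: nim_edge_cases)
    define C where "C = {b \<in> B - {v, w}. \<forall>u\<in>{v, w}. c {u, b} = j}"
    have CB: "C \<subseteq> B" "v \<notin> C" "w \<notin> C" by (auto simp: C_def)
    have Cj: "c {v, b} = j" "c {w, b} = j" if "b \<in> C" for b using that by (auto simp: C_def)
    have "h \<le> card C"
      unfolding C_def using disj vw card_parts_pos h2 by (intro common) auto
    also have "\<dots> \<le> card ({v, w} \<union> C)" using fin CB finite_subset by (intro card_mono) auto
    finally have "card (verts H) \<le> card ({v, w} \<union> C)" using h by simp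
    moreover have "{v, w} \<union> C \<subseteq> {..<n}" using vw Bn CB by blast
    moreover have "c {a, b} = j" if "a \<in> {v, w} \<union> C" "b \<in> {v, w} \<union> C" "a \<noteq> b" for a b
    proof (cases "a \<in> C \<and> b \<in> C")
      case True
      then show ?thesis using clique[of a b] B(1) CB that(3) by blast
    next
      case False
      then show ?thesis using that Cj[of a] Cj[of b] e vw(1) by (auto simp: insert_commute)
    qed
    ultimately have "{v, w} \<notin> nim_edges n H c"
      using vw(4) by (intro clique_not_nim[where K = "{v, w} \<union> C" and i = j]) simp_all
    then show False using e vw by simp
  qed
  \<comment> \<open>Otherwise \<open>card P\<close> vertices of \<open>T u\<close> form a
    \<open>j\<close>-biclique with \<open>u\<close> and their common \<open>j\<close>-neighbours in
    \<open>B\<close>, and it contains NIM-edges at \<open>u\<close>.\<close>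
  have cT: "card (T u) \<le> card P" if u: "u \<in> U" for u
  proof (rule ccontr)
    assume "\<not> ?thesis"
    then obtain W where W: "W \<subseteq> T u" "card W = card P"
      by (meson nat_le_linear obtain_subset_with_card_n)
    let ?C = "{b \<in> B - W. \<forall>w\<in>W. c {w, b} = j}"
    obtain v where v: "v \<in> W" using W card_parts_pos by fastforce
    have "h \<le> card ?C" using W h2 by (intro common) (auto simp: T_def)
    also have "\<dots> \<le> card (insert u ?C)" using fin by (intro card_mono) auto
    finally have "{v, u} \<notin> nim_edges n H c"
      using W u U Bn h2 v
      by (intro biclique_not_nim[of W n "insert u ?C" v u c j]) (auto simp: T_def insert_commute)
    then show False using v W by (auto simp: T_def insert_commute)
  qed
  have "?N \<subseteq> (\<Union>u\<in>U. (\<lambda>v. {u, v}) ` (U \<union> T u))"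
  proof
    fix e assume e: "e \<in> ?N"
    then obtain u where u: "u \<in> e" "u \<in> U" using touch by blast
    then obtain v where "e = {u, v}" "v < n"
      using e nim_edge_cases[of e n H c] by auto
    then show "e \<in> (\<Union>u\<in>U. (\<lambda>v. {u, v}) ` (U \<union> T u))" using e u by (auto simp: T_def)
  qed
  moreover have finT: "finite (T u)" for u by (simp add: T_def)
  ultimately have "card ?N \<le> card (\<Union>u\<in>U. (\<lambda>v. {u, v}) ` (U \<union> T u))"
    using fin by (intro card_mono) auto
  also have "\<dots> \<le> (\<Sum>u\<in>U. card ((\<lambda>v. {u, v}) ` (U \<union> T u)))" using fin card_UN_le by blast
  also have "\<dots> \<le> (\<Sum>u\<in>U. 2 * card P)"
  proof (rule sum_mono)
    fix u assume u: "u \<in> U"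
    have "card ((\<lambda>v. {u, v}) ` (U \<union> T u)) \<le> card (U \<union> T u)" using fin finT by (simp add: card_image_le)
    also have "\<dots> \<le> card U + card (T u)" by (rule card_Un_le)
    also have "\<dots> \<le> 2 * card P" using cT[OF u] cU card_parts_pos by simp
    finally show "card ((\<lambda>v. {u, v}) ` (U \<union> T u)) \<le> 2 * card P" .
  qed
  also have "\<dots> \<le> card P * (2 * card P)" using cU card_parts_pos by simp
  \<comment> \<open>\<open>2 * card P\<close> is at most \<open>h\<close> because \<open>P\<close>
    is the smaller part.\<close>
  also have "\<dots> \<le> h * h" using h2 card_parts by (intro mult_mono) auto
  finally show ?thesis by (simp add: power2_eq_square)
qed

text \<open>\<open>D\<close> is a Ramsey number depending only on \<open>h\<close> and
  \<open>card P\<close>, hence uniform in \<open>n\<close> and the colouring.\<close>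

lemma large_nim_degree:
  assumes h: "card (verts H) \<le> h"
  shows "\<exists>D. \<forall>n c i j x. i \<noteq> j \<longrightarrow> (\<forall>e\<in>all_edges {..<n}. c e = i \<or> c e = j) \<longrightarrow> x < n \<longrightarrow>
      D \<le> card {e \<in> {e \<in> nim_edges n H c. c e = i}. x \<in> e} \<longrightarrow>
    card {e \<in> nim_edges n H c. c e = j} \<le> h\<^sup>2"
proof -
  obtain D where D: "\<And>(V :: nat set) E. finite V \<Longrightarrow> D \<le> card V \<Longrightarrow>
      \<exists>R \<subseteq> V. card R = h \<and> clique R E \<or> card R = threshold h (card P - 1) \<and> indep R E"
    using ramsey2[of h "threshold h (card P - 1)"] by metis
  show ?thesis
  proof (intro exI allI impI)
    fix n i j x and c :: "nat set \<Rightarrow> nat"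
    assume ij: "i \<noteq> j" and col: "\<forall>e\<in>all_edges {..<n}. c e = i \<or> c e = j" and x: "x < n"
      and deg: "D \<le> card {e \<in> {e \<in> nim_edges n H c. c e = i}. x \<in> e}"
    let ?N = "{e \<in> nim_edges n H c. c e = i}"
    have N: "?N \<subseteq> all_edges {..<n}" using nim_edges_subset by blast
    define S where "S = {y. {x, y} \<in> ?N}"
    have S: "S \<subseteq> {..<n}" "x \<notin> S" using N by (auto simp: S_def)
    have "D \<le> card S" using deg card_incident_edges[OF N, of x] by (simp add: S_def)
    moreover have "finite S" using S finite_subset by blast
    ultimately obtain R where R: "R \<subseteq> S" "card R = h \<and> clique R {e. c e = i} \<or>
        card R = threshold h (card P - 1) \<and> indep R {e. c e = i}"
      using D by blast
    have xR: "x \<notin> R" "R \<subseteq> {..<n}" "\<And>a. a \<in> R \<Longrightarrow> {x, a} \<in> nim_edges n H c \<and> c {x, a} = i"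
      using R(1) S by (auto simp: S_def)
    show "card {e \<in> nim_edges n H c. c e = j} \<le> h\<^sup>2"
      using R(2)
    proof
      \<comment> \<open>Adding \<open>x\<close> keeps \<open>R\<close> a clique of colour
        \<open>i\<close>, which would then contain NIM-edges at \<open>x\<close>.\<close>
      assume *: "card R = h \<and> clique R {e. c e = i}"
      then have "card R > 0" using h card_verts card_parts_pos by simp
      then obtain a where a: "a \<in> R" by fastforce
      have "card R \<le> card (insert x R)"
        using xR(2) finite_subset by (intro card_mono) auto
      then have "{x, a} \<notin> nim_edges n H c"
        using * a xR x h by (intro clique_not_nim[of "insert x R" n x a c i])
          (auto simp: clique_def insert_commute)
      then show ?thesis using xR a by blast
    next
      \<comment> \<open>With only two colours, independence in colour \<open>i\<close> means a
        clique in colour \<open>j\<close>.\<close>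
      assume *: "card R = threshold h (card P - 1) \<and> indep R {e. c e = i}"
      show ?thesis
      proof (rule opposite_colour_class_bounded[OF h ij _ x])
        show "c {v, w} = j" if "v \<in> R" "w \<in> R" "v \<noteq> w" for v w
          using * that col[rule_format, of "{v, w}"] xR(2) by (auto simp: indep_def)
      qed (use * xR col in auto)
    qed
  qed
qed

text \<open>If some vertex has large NIM-degree in one colour, that colour contributes at most
  \<open>ex n H\<close> and the other at most \<open>h\<^sup>2\<close>. Otherwise each colour has at
  most half of \<open>D * n\<close> NIM-edges, and superlinearity of \<open>ex\<close>
  finishes.\<close>

lemma nim_le:
  assumes h: "card (verts H) \<le> h" and cyc: "contains_cycle H"
  shows "\<exists>n0. \<forall>n\<ge>n0. nim 2 n H \<le> ex n H + h\<^sup>2"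
proof -
  obtain D where D: "\<forall>n c i j x. i \<noteq> j \<longrightarrow> (\<forall>e\<in>all_edges {..<n}. c e = i \<or> c e = j) \<longrightarrow> x < n \<longrightarrow>
      D \<le> card {e \<in> {e \<in> nim_edges n H c. c e = i}. x \<in> e} \<longrightarrow>
    card {e \<in> nim_edges n H c. c e = j} \<le> h\<^sup>2"
    using large_nim_degree[OF h] ..
  obtain n0 where n0: "\<And>n. n0 \<le> n \<Longrightarrow> D * n \<le> ex n H"
    using ex_superlinear[OF simple cyc] by blast
  have bound: "card (nim_edges n H c) \<le> ex n H + h\<^sup>2"
    if n: "n0 \<le> n" and c: "edge_colouring 2 (complete_graph n) c" for n c
  proof -
    define N where "N i = {e \<in> nim_edges n H c. c e = i}" for i
    have col: "c e = 0 \<or> c e = 1" if "e \<in> all_edges {..<n}" for e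
    proof -
      have "c e < 2" using c that by (auto simp: edge_colouring_def)
      then show ?thesis by (simp add: less_2_cases_iff)
    qed
    have Nsub: "N i \<subseteq> all_edges {..<n}" for i using nim_edges_subset[of n H c] by (auto simp: N_def)
    have "nim_edges n H c = N 0 \<union> N 1"
      using col nim_edges_subset[of n H c] by (auto simp: N_def)
    then have split: "card (nim_edges n H c) \<le> card (N 0) + card (N 1)"
      by (simp add: card_Un_le)
    have le: "card (N i) \<le> ex n H" for i by (simp add: N_def nim_colour_class_le_ex)
    show ?thesis
    proof (cases "\<exists>i\<in>{0,1}. \<exists>x<n. D \<le> card {e \<in> N i. x \<in> e}")
      case True
      then obtain i x where ix: "i \<in> {0, 1}" "x < n" "D \<le> card {e \<in> N i. x \<in> e}" by blast
      \<comment> \<open>Swaps the colours \<open>0\<close> and \<open>1\<close>.\<close>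
      define j where "j = 1 - i"
      have j: "i \<noteq> j" "\<forall>e\<in>all_edges {..<n}. c e = i \<or> c e = j" "j \<in> {0, 1}"
        using col ix(1) by (auto simp: j_def dest!: col)
      have "card (N j) \<le> h\<^sup>2" using D j(1,2) ix(2,3) unfolding N_def by blast
      then have "card (N 1) \<le> h\<^sup>2 \<or> card (N 0) \<le> h\<^sup>2" using j(3) by auto
      then show ?thesis using split le[of 0] le[of 1] by linarith
    next
      case False
      have "2 * card (N i) \<le> D * n" if "i \<in> {0, 1}" for i
      proof -
        have "2 * card (N i) = (\<Sum>v<n. card {e \<in> N i. v \<in> e})"
          using sum_degrees[of "{..<n}" "N i"] Nsub by simp
        also have "\<dots> \<le> (\<Sum>v<n. D)"
          using False that by (intro sum_mono) (meson lessThan_iff nat_le_linear)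
        finally show ?thesis by (simp add: mult.commute)
      qed
      from this[of 0] this[of 1] show ?thesis using split n0[OF n] by simp
    qed
  qed
  have "nim 2 n H \<le> ex n H + h\<^sup>2" if "n0 \<le> n" for n
    unfolding nim_def
  proof (rule Max.boundedI)
    show "finite {card (nim_edges n H c) |c. edge_colouring 2 (complete_graph n) c}"
      by (rule nim_set_finite)
    show "{card (nim_edges n H c) |c. edge_colouring 2 (complete_graph n) c} \<noteq> {}"
      by (rule nim_set_nonempty) simp
  qed (use bound that in blast)
  then show ?thesis by blast
qed

end

theorem theorem1p12:
  fixes H :: "'a ugraph" and h :: nat
  assumes "simple_graph H" and "card (verts H) \<le> h"
    and "bipartite H" and "contains_cycle H"
  shows "\<exists>n0. \<forall>n\<ge>n0. nim 2 n H \<le> ex n H + h\<^sup>2"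
proof -
  obtain xs where xs: "is_cycle H xs" using assms by (auto simp: contains_cycle_def)
  then have "{xs ! 0, xs ! (Suc 0 mod length xs)} \<in> edges H" unfolding is_cycle_def by force
  then obtain e where e: "e \<in> edges H" by blast
  obtain A B where AB: "A \<union> B = verts H" "A \<inter> B = {}"
      "\<And>e. e \<in> edges H \<Longrightarrow> \<exists>a\<in>A. \<exists>b\<in>B. e = {a, b}"
    using assms(3) unfolding bipartite_def by metis
  obtain a b where ab: "a \<in> A" "b \<in> B" "{a, b} \<in> edges H" using AB(3)[OF e] e by blast
  \<comment> \<open>The parts are interchanged if necessary so that the smaller one plays the role
    of \<open>P\<close>.\<close>
  have "bipartite_edge H A B a b \<or> bipartite_edge H B A b a"
  proof (cases "card A \<le> card B")
    case True
    then have "bipartite_edge H A B a b" using assms(1) AB ab by unfold_locales auto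
    then show ?thesis ..
  next
    case False
    have "\<exists>b\<in>B. \<exists>a\<in>A. e = {b, a}" if "e \<in> edges H" for e
      using AB(3)[OF that] by (metis insert_commute)
    then have "bipartite_edge H B A b a"
      using assms(1) AB ab False by unfold_locales (auto simp: insert_commute)
    then show ?thesis ..
  qed
  then show ?thesis using bipartite_edge.nim_le[OF _ assms(2,4)] by (elim disjE)
qed

end
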